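(* Let $G^{1\ldots k}$ be a system of $k$ networks with user set $U$, let $G$ be the coupled network with vertex set $V$ produced from $G^{1\ldots k}$ by the clique lossless coupling scheme, let $0<\beta\le 1$, and let $d\ge1$ be an integer. A set of users $S=\{s_1,\ldots,s_p\}\subseteq U$ influences $\beta$ fraction of the users in $G^{1\ldots k}$ after $d$ propagation hops (i.e. $|A^d(G^{1\ldots k},S)|\ge\beta|U|$) if and only if the set of gateway vertices $S'=\{s_1^0,\ldots,s_p^0\}$ influences $\beta$ fraction of the vertices in $G$ after $2d$ propagation hops (i.e. $|A^{2d}(G,S')|\ge\beta|V|$).
   Context: Multiplex system. $G^{1\ldots k}$ consists of $k$ finite weighted directed graphs $G^i=(V^i,E^i,\theta^i,W^i)$, $1\le i\le k$, without self-loops, with edge weights $w^i(u,v)\ge 0$ for $(u,v)\in E^i$ and a threshold $\theta^i(u)$ for each $u\in V^i$. The same user may belong to several $V^i$. $U=\bigcup_{i=1}^k V^i$ is the set of all users. $N_u^{i-}$ is the set of in-neighbors of $u$ in $G^i$. Propagation in the system (Linear Threshold model). Given a seed set $S\subseteq U$, the users in $S$ are active at time $0$ and all others inactive. Active users remain active. At time $t\ge1$ an inactive user $u$ becomes active iff there is some $i$ with $u\in V^i$ and $\sum_{v\in N_u^{i-}\cap A} w^i(v,u)\ge\theta^i(u)$, where $A$ is the set of users active after time $t-1$. $A^d(G^{1\ldots k},S)$ is the set of users active after $d$ time steps (propagation hops). Propagation in a single network is the case $k=1$ of this, and $A^{d}(G,S')$ is the corresponding set of active vertices. Clique lossless coupling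 scheme. The coupled network $G$ is the following single weighted directed graph with thresholds. For each user $u\in U$ there are $k+1$ vertices: a gateway vertex $u^0$ and representative vertices $u^1,\ldots,u^k$. If $u\notin V^i$, then $u^i$ is called a dummy vertex. Thresholds: $\theta(u^0)=1$; $\theta(u^i)=1$ if $u^i$ is a dummy vertex; $\theta(u^i)=\theta^i(u)$ if $u\in V^i$. Edges: for every $(u,v)\in E^i$ there is an edge $(u^0,v^i)$ with weight $w(u^0,v^i)=w^i(u,v)$; and for every user $u$ and all $0\le i,j\le k$ with $i\ne j$ there is an edge $(u^i,u^j)$ with weight $w(u^i,u^j)=\theta(u^j)$. There are no other edges. *)

theory Defs
  imports Complex_Main "Graph_Theory.Pair_Digraph"
begin

text \<open>
  Arcs of the underlying digraph are ordered pairs of vertices, so there are no parallel arcs.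
  Threshold and weight are total functions; only their values on vertices and arcs matter.
\<close>

record 'a network =
  net_graph :: "'a pair_pre_digraph"
  threshold :: "'a \<Rightarrow> real"
  weight :: "'a \<Rightarrow> 'a \<Rightarrow> real"

abbreviation net_verts :: "'a network \<Rightarrow> 'a set" where
  "net_verts N \<equiv> pverts (net_graph N)"

abbreviation net_arcs :: "'a network \<Rightarrow> ('a \<times> 'a) set" where
  "net_arcs N \<equiv> parcs (net_graph N)"

text \<open>The locale predicate \<open>pair_digraph\<close> says: well-formed, finite and without self-loops.\<close>

definition wf_network :: "'a network \<Rightarrow> bool" where
  "wf_network N \<longleftrightarrow>
     pair_digraph (net_graph N) \<and> (\<forall>(u, v) \<in> net_arcs N. 0 \<le> weight N u v)"

definition in_neighbors :: "'a network \<Rightarrow> 'a \<Rightarrow> 'a set" where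
  "in_neighbors N u = {v. (v, u) \<in> net_arcs N}"

text \<open>
  A multiplex system of \<open>k\<close> networks is a family \<open>G\<close> of which only the members
  \<open>G 1, ..., G k\<close> are relevant. A user belonging to several networks is the same element of the
  vertex type in all of them.
\<close>

definition multiplex_system :: "nat \<Rightarrow> (nat \<Rightarrow> 'a network) \<Rightarrow> bool" where
  "multiplex_system k G \<longleftrightarrow> (\<forall>i\<in>{1..k}. wf_network (G i))"

definition users :: "nat \<Rightarrow> (nat \<Rightarrow> 'a network) \<Rightarrow> 'a set" where
  "users k G = (\<Union>i\<in>{1..k}. net_verts (G i))"

primrec active :: "nat \<Rightarrow> (nat \<Rightarrow> 'a network) \<Rightarrow> 'a set \<Rightarrow> nat \<Rightarrow> 'a set" where
  "active k G S 0 = S"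
| "active k G S (Suc t) = active k G S t \<union>
     {u. \<exists>i\<in>{1..k}. u \<in> net_verts (G i) \<and>
        (\<Sum>v\<in>in_neighbors (G i) u \<inter> active k G S t. weight (G i) v u) \<ge> threshold (G i) u}"

definition influences_fraction ::
    "real \<Rightarrow> nat \<Rightarrow> (nat \<Rightarrow> 'a network) \<Rightarrow> 'a set \<Rightarrow> nat \<Rightarrow> bool" where
  "influences_fraction \<beta> k G S d \<longleftrightarrow>
     real (card (active k G S d)) \<ge> \<beta> * real (card (users k G))"

text \<open>A single network is the system with \<open>k = 1\<close>; its users are exactly its vertices.\<close>

definition single_influences_fraction :: "real \<Rightarrow> 'a network \<Rightarrow> 'a set \<Rightarrow> nat \<Rightarrow> bool" where
  "single_influences_fraction \<beta> N S d \<longleftrightarrow>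
     real (card (active 1 (\<lambda>_. N) S d)) \<ge> \<beta> * real (card (net_verts N))"

text \<open>
  In the coupled network the pair \<open>(u, 0)\<close> is the gateway vertex of \<open>u\<close>, and \<open>(u, i)\<close> with
  \<open>1 \<le> i \<le> k\<close> is its \<open>i\<close>-th representative vertex.
\<close>

abbreviation gateway :: "'a \<Rightarrow> 'a \<times> nat" where
  "gateway u \<equiv> (u, 0)"

definition clique_threshold :: "(nat \<Rightarrow> 'a network) \<Rightarrow> 'a \<times> nat \<Rightarrow> real" where
  "clique_threshold G = (\<lambda>(u, i).
     if i = 0 \<or> u \<notin> net_verts (G i) then 1 else threshold (G i) u)"

text \<open>
  The two kinds of arcs are told apart by their end points: arcs inside the clique of a user join
  vertices of the same user, whereas arcs coming from \<open>G i\<close> join vertices of different users,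
  because \<open>G i\<close> has no self-loops.
\<close>

definition clique_coupling :: "nat \<Rightarrow> (nat \<Rightarrow> 'a network) \<Rightarrow> ('a \<times> nat) network" where
  "clique_coupling k G =
     \<lparr> net_graph =
         \<lparr> pverts = users k G \<times> {0..k},
           parcs = {(gateway u, (v, i)) | u v i. i \<in> {1..k} \<and> (u, v) \<in> net_arcs (G i)} \<union>
                   {((u, i), (u, j)) | u i j. u \<in> users k G \<and> i \<le> k \<and> j \<le> k \<and> i \<noteq> j} \<rparr>,
       threshold = clique_threshold G,
       weight = (\<lambda>(u, i) (v, j). if u = v then clique_threshold G (v, j) else weight (G j) u v) \<rparr>"

end

theory Submission
  imports Defs
begin

text \<open>
  One step of the system is simulated by two steps of the coupled network. If the active vertices
  are the full cliques of the users in \<open>A\<close> (or, initially, just their gateways), then after one step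
  exactly those representatives \<open>(u, i)\<close> have joined for which \<open>u\<close> is activated by \<open>A\<close> in \<open>G i\<close>, and
  no new gateway has; the second step completes the cliques of these users. So after \<open>2 * d\<close> steps,
  \<open>d \<ge> 1\<close>, the active vertices are the full cliques of the active users, and both fractions agree.
\<close>

definition activates :: "'a network \<Rightarrow> 'a set \<Rightarrow> 'a \<Rightarrow> bool" where
  "activates N A u \<longleftrightarrow>
     u \<in> net_verts N \<and> threshold N u \<le> (\<Sum>v\<in>in_neighbors N u \<inter> A. weight N v u)"

lemma active_Suc:
  "active k G S (Suc t) = active k G S t \<union> {u. \<exists>i\<in>{1..k}. activates (G i) (active k G S t) u}"
  by (simp add: activates_def)

lemma active_single_Suc:
  "active 1 (\<lambda>_. N) S (Suc t) =
     active 1 (\<lambda>_. N) S t \<union> {u. activates N (active 1 (\<lambda>_. N) S t) u}"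
  by (simp add: activates_def)

lemma active_subset_users: "S \<subseteq> users k G \<Longrightarrow> active k G S t \<subseteq> users k G"
  by (induction t) (auto simp: users_def)

section \<open>Facts about the member networks\<close>

context
  fixes k :: nat and G :: "nat \<Rightarrow> 'a network"
  assumes sys: "multiplex_system k G"
begin

lemma
  assumes "i \<in> {1..k}"
  shows finite_net_verts: "finite (net_verts (G i))"
    and net_arcs_subset: "net_arcs (G i) \<subseteq> net_verts (G i) \<times> net_verts (G i)"
    and no_self_loop: "(u, u) \<notin> net_arcs (G i)"
    and weight_nonneg: "(u, v) \<in> net_arcs (G i) \<Longrightarrow> 0 \<le> weight (G i) u v"
proof -
  have wf: "wf_network (G i)"
    using sys assms by (simp add: multiplex_system_def)
  then interpret pair_digraph "net_graph (G i)"
    by (simp add: wf_network_def)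
  show "finite (net_verts (G i))" by simp
  show "net_arcs (G i) \<subseteq> net_verts (G i) \<times> net_verts (G i)"
    by (auto dest: in_arcsD1 in_arcsD2)
  show "(u, u) \<notin> net_arcs (G i)"
    using no_loops by fastforce
  show "(u, v) \<in> net_arcs (G i) \<Longrightarrow> 0 \<le> weight (G i) u v"
    using wf by (auto simp: wf_network_def)
qed

lemma finite_in_neighbors: "i \<in> {1..k} \<Longrightarrow> finite (in_neighbors (G i) u)"
  using net_arcs_subset[of i]
  by (intro finite_subset[OF _ finite_net_verts[of i]]) (auto simp: in_neighbors_def)

lemma influx_nonneg: "i \<in> {1..k} \<Longrightarrow> 0 \<le> (\<Sum>v\<in>in_neighbors (G i) u \<inter> A. weight (G i) v u)"
  by (rule sum_nonneg) (auto simp: in_neighbors_def weight_nonneg)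

section \<open>Influx into gateways and representatives\<close>

lemma in_neighbors_coupling_gateway:
  assumes "u \<in> users k G"
  shows "in_neighbors (clique_coupling k G) (gateway u) = {u} \<times> {1..k}"
  using assms by (auto simp: in_neighbors_def clique_coupling_def)

lemma in_neighbors_coupling_representative:
  assumes "u \<in> users k G" "i \<in> {1..k}"
  shows "in_neighbors (clique_coupling k G) (u, i) =
           gateway ` in_neighbors (G i) u \<union> {u} \<times> ({0..k} - {i})"
  using assms by (auto simp: in_neighbors_def clique_coupling_def)

lemma sum_clique_weight:
  assumes "finite J"
  shows "(\<Sum>x\<in>{u} \<times> J \<inter> X. weight (clique_coupling k G) x (u, i)) =
           real (card {j \<in> J. (u, j) \<in> X}) * clique_threshold G (u, i)"
proof -
  have "{u} \<times> J \<inter> X = Pair u ` {j \<in> J. (u, j) \<in> X}"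
    by auto
  then show ?thesis
    by (simp add: sum.reindex inj_on_def clique_coupling_def)
qed

lemma influx_gateway:
  assumes "u \<in> users k G"
  shows "(\<Sum>x\<in>in_neighbors (clique_coupling k G) (gateway u) \<inter> X.
            weight (clique_coupling k G) x (gateway u)) = real (card {j \<in> {1..k}. (u, j) \<in> X})"
  unfolding in_neighbors_coupling_gateway[OF assms]
  by (subst sum_clique_weight) (auto simp: clique_threshold_def)

lemma influx_representative:
  assumes "u \<in> users k G" and i: "i \<in> {1..k}"
  shows "(\<Sum>x\<in>in_neighbors (clique_coupling k G) (u, i) \<inter> X.
            weight (clique_coupling k G) x (u, i)) =
         (\<Sum>v\<in>in_neighbors (G i) u \<inter> {v. gateway v \<in> X}. weight (G i) v u) +
         real (card {j \<in> {0..k} - {i}. (u, j) \<in> X}) * clique_threshold G (u, i)"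
proof -
  let ?w = "\<lambda>x. weight (clique_coupling k G) x (u, i)"
  let ?B = "in_neighbors (G i) u \<inter> {v. gateway v \<in> X}"
  \<comment> \<open>Used twice: it keeps \<open>gateway u\<close> out of the first group of
    in-neighbors, so the groups are disjoint, and it sends every \<open>gateway v\<close> of that
    group to the \<open>else\<close> branch of the coupled weight.\<close>
  have u: "u \<notin> in_neighbors (G i) u"
    using no_self_loop[OF i] by (simp add: in_neighbors_def)
  have "in_neighbors (clique_coupling k G) (u, i) \<inter> X =
          gateway ` ?B \<union> {u} \<times> ({0..k} - {i}) \<inter> X"
    unfolding in_neighbors_coupling_representative[OF assms] by auto
  then have "sum ?w (in_neighbors (clique_coupling k G) (u, i) \<inter> X) =
      sum ?w (gateway ` ?B) + sum ?w ({u} \<times> ({0..k} - {i}) \<inter> X)"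
    using u finite_in_neighbors[OF i] by (simp, subst sum.union_disjoint) auto
  moreover have "sum ?w (gateway ` ?B) = (\<Sum>v\<in>?B. weight (G i) v u)"
    using u by (subst sum.reindex) (auto simp: inj_on_def clique_coupling_def intro!: sum.cong)
  ultimately show ?thesis
    by (simp add: sum_clique_weight)
qed

section \<open>Activation of a single vertex of the coupled network\<close>

text \<open>Clique arcs carry nothing here, so only arcs from gateways of other users remain. A
  gateway has no such incoming arcs and stays below its threshold 1, while a representative sees
  exactly the influx that its user has in \<open>G i\<close>.\<close>

lemma activates_coupling_inactive_clique:
  assumes inactive: "\<And>j. j \<le> k \<Longrightarrow> (u, j) \<notin> X"
  shows "activates (clique_coupling k G) X (u, i) \<longleftrightarrow>
           i \<in> {1..k} \<and> activates (G i) {v. gateway v \<in> X} u"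
proof (cases "u \<in> users k G \<and> i \<le> k")
  case False
  then show ?thesis
    by (auto simp: activates_def clique_coupling_def users_def)
next
  case True
  then have u: "u \<in> users k G" and vert: "(u, i) \<in> net_verts (clique_coupling k G)"
    by (auto simp: clique_coupling_def)
  have thr: "threshold (clique_coupling k G) = clique_threshold G"
    by (simp add: clique_coupling_def)
  have none: "{j \<in> J. (u, j) \<in> X} = {}" if "J \<subseteq> {0..k}" for J
    using inactive that by fastforce
  show ?thesis
  proof (cases "i = 0")
    case True
    have "{j \<in> {1..k}. (u, j) \<in> X} = {}"
      by (rule none) auto
    then have influx: "(\<Sum>x\<in>in_neighbors (clique_coupling k G) (gateway u) \<inter> X.
            weight (clique_coupling k G) x (gateway u)) = 0"
      using influx_gateway[OF u, of X] by (simp only: card.empty of_nat_0)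
    show ?thesis
      unfolding activates_def True influx by (simp add: thr clique_threshold_def)
  next
    case False
    with True have i: "i \<in> {1..k}" by simp
    have "{j \<in> {0..k} - {i}. (u, j) \<in> X} = {}"
      by (rule none) auto
    then have influx: "(\<Sum>x\<in>in_neighbors (clique_coupling k G) (u, i) \<inter> X.
            weight (clique_coupling k G) x (u, i)) =
         (\<Sum>v\<in>in_neighbors (G i) u \<inter> {v. gateway v \<in> X}. weight (G i) v u)"
      using influx_representative[OF u i, of X] by (simp only: card.empty of_nat_0 mult_zero_left add_0_right)
    \<comment> \<open>A dummy vertex receives 0, below its threshold 1.\<close>
    have "in_neighbors (G i) u = {}" if "u \<notin> net_verts (G i)"
      using that net_arcs_subset[OF i] by (auto simp: in_neighbors_def)
    then show ?thesis
      unfolding activates_def influx using vert i False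
      by (auto simp: thr clique_threshold_def)
  qed
qed

text \<open>
  A clique arc weighs as much as the threshold of its head. If that threshold is negative, two active
  clique members already contribute less than it; hence the last assumption.
\<close>

lemma activates_coupling_active_clique:
  assumes u: "u \<in> users k G" and "i \<le> k"
    and j: "j \<le> k" "j \<noteq> i" "(u, j) \<in> X"
    and thr: "0 \<le> clique_threshold G (u, i) \<or> (\<forall>j'. (u, j') \<in> X \<longrightarrow> j' = j)"
  shows "activates (clique_coupling k G) X (u, i)"
proof -
  let ?\<theta> = "clique_threshold G (u, i)"
  \<comment> \<open>\<open>J\<close> stands for the possible clique sources: \<open>{1..k}\<close>
    for a gateway, \<open>{0..k} - {i}\<close> for a representative. Both contain the active member
    \<open>j\<close>, whose arc alone supplies the threshold.\<close>
  have clique: "?\<theta> \<le> real (card {j \<in> J. (u, j) \<in> X}) * ?\<theta>" if "finite J" "j \<in> J" for J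
    using thr
  proof
    assume "0 \<le> ?\<theta>"
    moreover have "1 \<le> card {j \<in> J. (u, j) \<in> X}"
      using that j by (auto simp: Suc_le_eq card_gt_0_iff)
    ultimately show ?thesis
      using mult_right_mono[of 1 "real (card {j \<in> J. (u, j) \<in> X})" ?\<theta>] by simp
  next
    assume "\<forall>j'. (u, j') \<in> X \<longrightarrow> j' = j"
    then have "{j \<in> J. (u, j) \<in> X} = {j}"
      using that j by blast
    then show ?thesis by simp
  qed
  have "?\<theta> \<le> (\<Sum>x\<in>in_neighbors (clique_coupling k G) (u, i) \<inter> X.
                weight (clique_coupling k G) x (u, i))"
  proof (cases "i = 0")
    case True
    then show ?thesis
      using influx_gateway[OF u, of X] clique[of "{1..k}"] j by (auto simp: clique_threshold_def)
  next
    case False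
    with assms have i: "i \<in> {1..k}" by simp
    show ?thesis
      using influx_representative[OF u i, of X] clique[of "{0..k} - {i}"]
        influx_nonneg[OF i, of u "{v. gateway v \<in> X}"] j by simp
  qed
  then show ?thesis
    using assms by (simp add: activates_def clique_coupling_def)
qed

section \<open>The two half steps\<close>

definition half_step :: "'a set \<Rightarrow> ('a \<times> nat) set" where
  "half_step A = A \<times> {0..k} \<union> {(u, i). i \<in> {1..k} \<and> activates (G i) A u}"

text \<open>Both shapes of \<open>X\<close> have the same active gateways, so users outside
  \<open>A\<close> see the same influx; for users in \<open>A\<close> the active gateway completes
  the clique.\<close>

lemma first_half_step:
  assumes A: "A \<subseteq> users k G" and X: "X = gateway ` A \<or> X = A \<times> {0..k}"
  shows "X \<union> {x. activates (clique_coupling k G) X x} = half_step A"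
proof (rule set_eqI, unfold split_paired_all)
  fix u i
  have gw: "{v. gateway v \<in> X} = A"
    using X by auto
  have XA: "X \<subseteq> A \<times> {0..k}"
    using X by auto
  show "(u, i) \<in> X \<union> {x. activates (clique_coupling k G) X x} \<longleftrightarrow> (u, i) \<in> half_step A"
  proof (cases "u \<in> A")
    case False
    then have "\<And>j. (u, j) \<notin> X"
      using XA by auto
    with False show ?thesis
      using activates_coupling_inactive_clique[of u X i] by (auto simp: half_step_def gw)
  next
    case True
    show ?thesis
    proof (cases "i \<le> k")
      case False
      then show ?thesis
        using XA by (auto simp: half_step_def activates_def clique_coupling_def)
    next
      case ik: True
      \<comment> \<open>If \<open>(u, i)\<close> is missing, \<open>X\<close> can only be the set of
        gateways. Then the gateway is the sole active member of the clique, and a negative threshold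
        does no harm.\<close>
      have "activates (clique_coupling k G) X (u, i)" if "(u, i) \<notin> X"
        using that X True A ik
        by (intro activates_coupling_active_clique[where j = 0]) auto
      then show ?thesis
        using True ik by (auto simp: half_step_def)
    qed
  qed
qed

text \<open>The active gateways are still those of \<open>A\<close>, so no user outside the new set
  gains a vertex; each newly activated user has an active representative that completes its
  clique.\<close>

lemma second_half_step:
  assumes A: "A \<subseteq> users k G"
  shows "half_step A \<union> {x. activates (clique_coupling k G) (half_step A) x} =
           (A \<union> {u. \<exists>i\<in>{1..k}. activates (G i) A u}) \<times> {0..k}" (is "_ = ?A' \<times> _")
proof (rule set_eqI, unfold split_paired_all)
  fix u i
  let ?Y = "half_step A"
  have gw: "{v. gateway v \<in> ?Y} = A"
    by (auto simp: half_step_def)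
  have YA: "?Y \<subseteq> ?A' \<times> {0..k}"
    by (auto simp: half_step_def)
  show "(u, i) \<in> ?Y \<union> {x. activates (clique_coupling k G) ?Y x} \<longleftrightarrow> (u, i) \<in> ?A' \<times> {0..k}"
  proof (cases "u \<in> ?A' \<and> i \<le> k")
    case False
    then have "\<not> activates (clique_coupling k G) ?Y (u, i)"
    proof (cases "i \<le> k")
      case True
      with False have "u \<notin> ?A'" by simp
      then have "\<And>j. (u, j) \<notin> ?Y"
        using YA by blast
      with \<open>u \<notin> ?A'\<close> show ?thesis
        using activates_coupling_inactive_clique[of u ?Y i] unfolding gw by auto
    qed (auto simp: activates_def clique_coupling_def)
    then show ?thesis
      using False YA by auto
  next
    case True
    have "activates (clique_coupling k G) ?Y (u, i)" if notin: "(u, i) \<notin> ?Y"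
    proof -
      \<comment> \<open>As \<open>half_step A\<close> contains the whole cliques of
        \<open>A\<close>, the missing vertex belongs to a user outside \<open>A\<close>, activated
        in some \<open>G j\<close>.\<close>
      obtain j where j: "j \<in> {1..k}" "activates (G j) A u" "(u, j) \<in> ?Y"
        using True notin by (auto simp: half_step_def)
      then have "u \<in> users k G"
        by (auto simp: activates_def users_def)
      \<comment> \<open>A vertex with negative threshold was activated in the first half step.\<close>
      moreover have "0 \<le> clique_threshold G (u, i)"
      proof (rule ccontr)
        assume neg: "\<not> 0 \<le> clique_threshold G (u, i)"
        then have i: "i \<in> {1..k}" "u \<in> net_verts (G i)" "threshold (G i) u < 0"
          using True by (auto simp: clique_threshold_def split: if_splits)
        then have "activates (G i) A u"
          using influx_nonneg[of i u A] by (simp add: activates_def)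
        with i(1) notin show False
          by (simp add: half_step_def)
      qed
      moreover have "j \<noteq> i"
        using j notin by blast
      ultimately show ?thesis
        using True j by (intro activates_coupling_active_clique[where j = j]) auto
    qed
    then show ?thesis
      using True by auto
  qed
qed

section \<open>Iteration over time\<close>

lemma active_coupling:
  assumes S: "S \<subseteq> users k G"
  shows "active 1 (\<lambda>_. clique_coupling k G) (gateway ` S) (2 * Suc t) =
           active k G S (Suc t) \<times> {0..k}"
proof -
  let ?C = "active 1 (\<lambda>_. clique_coupling k G) (gateway ` S)"
  \<comment> \<open>The first alternative covers the start \<open>t = 0\<close>, where only gateways
    are active; the second is the invariant from hop 2 on.\<close>
  have two_steps: "?C (2 * Suc t) = active k G S (Suc t) \<times> {0..k}"
    if "?C (2 * t) = gateway ` active k G S t \<or> ?C (2 * t) = active k G S t \<times> {0..k}" for t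
  proof -
    have sub: "active k G S t \<subseteq> users k G"
      using S by (rule active_subset_users)
    have "?C (Suc (2 * t)) = half_step (active k G S t)"
      unfolding active_single_Suc using sub that by (rule first_half_step)
    then have "?C (Suc (Suc (2 * t))) = active k G S (Suc t) \<times> {0..k}"
      using second_half_step[OF sub]
      unfolding active_single_Suc[of _ _ "Suc (2 * t)"] active_Suc by simp
    then show ?thesis
      by (simp only: mult_Suc_right numeral_2_eq_2 add_Suc add_0)
  qed
  show ?thesis
  proof (induction t)
    case 0
    show ?case by (rule two_steps) simp
  next
    case (Suc t)
    then show ?case by (rule two_steps[OF disjI2])
  qed
qed

end

theorem theorem2:
  fixes G :: "nat \<Rightarrow> 'u network" and k d :: nat and \<beta> :: real and S :: "'u set"
  assumes "k \<ge> 1" and "multiplex_system k G"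
    and "0 < \<beta>" and "\<beta> \<le> 1"
    and "d \<ge> 1"
    and "S \<subseteq> users k G"
  shows "influences_fraction \<beta> k G S d \<longleftrightarrow>
         single_influences_fraction \<beta> (clique_coupling k G) (gateway ` S) (2 * d)"
proof -
  obtain t where t: "d = Suc t"
    using assms by (cases d) auto
  have "card (active 1 (\<lambda>_. clique_coupling k G) (gateway ` S) (2 * d)) =
          card (active k G S d) * Suc k"
    unfolding t active_coupling[OF assms(2,6)] by (simp add: card_cartesian_product)
  moreover have "card (net_verts (clique_coupling k G)) = card (users k G) * Suc k"
    by (simp add: clique_coupling_def card_cartesian_product)
  \<comment> \<open>Both cardinalities carry the factor \<open>Suc k\<close>, which is positive and
    cancels.\<close>
  moreover have "\<beta> * (real (card (users k G)) * real (Suc k))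
        \<le> real (card (active k G S d)) * real (Suc k) \<longleftrightarrow>
      \<beta> * real (card (users k G)) \<le> real (card (active k G S d))"
    unfolding mult.assoc[symmetric] by (rule mult_le_cancel_right_pos) simp
  ultimately show ?thesis
    by (simp only: influences_fraction_def single_influences_fraction_def of_nat_mult)
qed

end
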